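(* For every integer $n\ge0$, $a_{n,n}=b_{n,n}$.
   Context: For nonnegative integers $p,q$, $a_{p,q}$ denotes the number of ways to partition a set consisting of $p$ marked points on a line and $q$ marked points on a parallel line into pairs, joining the two points of each pair by a straight segment, such that no two segments have a common point (in particular, no endpoint lies on another segment). In particular $a_{0,0}=1$. For integers $k,n\ge1$, consider $k$ marked points on a line and $n$ marked points on a parallel line. A configuration is a choice of segments, each joining two neighbouring points on the same line, such that no point is an endpoint of two chosen segments. Its objects are the chosen segments together with the points that are not endpoints of chosen segments. $b_{k,n}$ is the number of configurations in which the numbers of objects on the two lines are equal. By convention $b_{0,0}=1$. *)

theory Defs
  imports "HOL-Analysis.Analysis"
begin

text \<open>
  The straight segment joining the two points of a pair \<open>e\<close> is \<open>convex hull e\<close>.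
\<close>

definition crossing_free_pairings :: "'a::real_vector set \<Rightarrow> 'a set set set" where
  "crossing_free_pairings V =
     {M. partition_on V M \<and> (\<forall>e\<in>M. card e = 2) \<and>
         pairwise (\<lambda>e f. convex hull e \<inter> convex hull f = {}) M}"

text \<open>
  The marked points are placed at \<open>(0,0), \<dots>, (p-1,0)\<close> and \<open>(0,1), \<dots>, (q-1,1)\<close>. By
  \<open>card_crossing_free_pairings_eq_a_num\<close> below, every other placement on two distinct
  parallel lines gives the same number.
\<close>

definition marked_points :: "nat \<Rightarrow> nat \<Rightarrow> (real \<times> real) set" where
  "marked_points p q = (\<lambda>i. (real i, 0)) ` {..<p} \<union> (\<lambda>j. (real j, 1)) ` {..<q}"

definition a_num :: "nat \<Rightarrow> nat \<Rightarrow> nat" where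
  "a_num p q = card (crossing_free_pairings (marked_points p q))"

text \<open>
  For the second count only the order of the points on each line matters: the points of a line
  with \<open>k\<close> marked points are numbered \<open>0, \<dots>, k - 1\<close> along the line, and a segment between
  neighbouring points is represented by its set of endpoints.
\<close>

definition neighbour_segments :: "nat \<Rightarrow> nat set set" where
  "neighbour_segments k = {{i, Suc i} |i. Suc i < k}"

definition segment_choices :: "nat \<Rightarrow> nat set set set" where
  "segment_choices k = {S. S \<subseteq> neighbour_segments k \<and> disjoint S}"

definition objects :: "nat \<Rightarrow> nat set set \<Rightarrow> (nat set + nat) set" where
  "objects k S = S <+> ({..<k} - \<Union>S)"

definition b_num :: "nat \<Rightarrow> nat \<Rightarrow> nat" where
  "b_num k n =
     card {(S, T). S \<in> segment_choices k \<and> T \<in> segment_choices n \<and>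
                   card (objects k S) = card (objects n T)}"

lemma a_num_0_0: "a_num 0 0 = 1"
proof -
  have "crossing_free_pairings (marked_points 0 0) = {{}}"
    by (auto simp: crossing_free_pairings_def marked_points_def partition_on_empty)
  then show ?thesis by (simp add: a_num_def)
qed

lemma b_num_0_0: "b_num 0 0 = 1"
proof -
  have "{(S, T). S \<in> segment_choices 0 \<and> T \<in> segment_choices 0 \<and>
                 card (objects 0 S) = card (objects 0 T)} = {({}, {})}"
    by (auto simp: segment_choices_def neighbour_segments_def)
  then show ?thesis by (simp add: b_num_def)
qed


subsection \<open>Independence of the placement of the marked points\<close>

lemma partition_on_image_iff:
  assumes "inj_on f V" "\<forall>e\<in>M. e \<subseteq> V"
  shows "partition_on (f ` V) ((`) f ` M) \<longleftrightarrow> partition_on V M"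
proof -
  have union: "\<Union> ((`) f ` M) = f ` V \<longleftrightarrow> \<Union> M = V"
  proof -
    have "\<Union> ((`) f ` M) = f ` (\<Union> M)" by blast
    moreover have "\<Union> M \<subseteq> V" using assms(2) by blast
    ultimately show ?thesis using assms(1) by (simp add: inj_on_image_eq_iff)
  qed
  have eq: "f ` e = f ` e' \<longleftrightarrow> e = e'" if "e \<in> M" "e' \<in> M" for e e'
    using that assms by (simp add: inj_on_image_eq_iff)
  have int: "f ` e \<inter> f ` e' = {} \<longleftrightarrow> e \<inter> e' = {}" if "e \<in> M" "e' \<in> M" for e e'
    using that assms inj_on_image_Int[OF assms(1), of e e'] by auto
  have "disjoint ((`) f ` M) \<longleftrightarrow> disjoint M"
    unfolding disjoint_def using eq int by auto
  then show ?thesis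
    unfolding partition_on_def using union by auto
qed

lemma crossing_free_pairings_image:
  assumes "inj_on f V"
  shows "crossing_free_pairings (f ` V) =
    (`) ((`) f) ` {M. partition_on V M \<and> (\<forall>e\<in>M. card e = 2) \<and>
       pairwise (\<lambda>e e'. convex hull (f ` e) \<inter> convex hull (f ` e') = {}) M}"
    (is "_ = _ ` ?R")
proof (intro equalityI subsetI)
  have key: "(`) f ` M \<in> crossing_free_pairings (f ` V) \<longleftrightarrow> M \<in> ?R"
    if M: "\<forall>e\<in>M. e \<subseteq> V" for M
  proof -
    have card: "card (f ` e) = card e" if "e \<in> M" for e
      using that M assms by (meson card_image inj_on_subset)
    have eq: "f ` e = f ` e' \<longleftrightarrow> e = e'" if "e \<in> M" "e' \<in> M" for e e'
      using that M assms by (simp add: inj_on_image_eq_iff)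
    show ?thesis
      unfolding crossing_free_pairings_def mem_Collect_eq partition_on_image_iff[OF assms M]
      using card eq by (auto simp: pairwise_def)
  qed
  fix N
  {
    assume N: "N \<in> crossing_free_pairings (f ` V)"
    then have "\<Union>N = f ` V"
      by (simp add: crossing_free_pairings_def partition_on_def)
    then have "N \<subseteq> Pow (f ` V)" by blast
    then have "N \<subseteq> (`) f ` Pow V"
      by (simp add: image_Pow_surj)
    then obtain M where M: "M \<subseteq> Pow V" "N = (`) f ` M"
      by (meson subset_imageE)
    with key[of M] N show "N \<in> (`) ((`) f) ` ?R" by blast
  next
    assume "N \<in> (`) ((`) f) ` ?R"
    then obtain M where M: "N = (`) f ` M" "M \<in> ?R" by blast
    then have "\<forall>e\<in>M. e \<subseteq> V" by (auto simp: partition_on_def)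
    with key[of M] M show "N \<in> crossing_free_pairings (f ` V)" by simp
  }
qed

lemma card_crossing_free_pairings_cong:
  assumes f: "inj_on f V" and g: "inj_on g V"
    and hull: "\<And>e e'. \<lbrakk>e \<subseteq> V; e' \<subseteq> V; card e = 2; card e' = 2\<rbrakk> \<Longrightarrow>
      convex hull (f ` e) \<inter> convex hull (f ` e') = {} \<longleftrightarrow>
      convex hull (g ` e) \<inter> convex hull (g ` e') = {}"
  shows "card (crossing_free_pairings (f ` V)) = card (crossing_free_pairings (g ` V))"
proof -
  define R where "R h = {M. partition_on V M \<and> (\<forall>e\<in>M. card e = 2) \<and>
       pairwise (\<lambda>e e'. h e e') M}" for h
  define F where "F = R (\<lambda>e e'. convex hull (f ` e) \<inter> convex hull (f ` e') = {})"
  define G where "G = R (\<lambda>e e'. convex hull (g ` e) \<inter> convex hull (g ` e') = {})"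
  have "F = G"
    unfolding F_def G_def R_def
  proof (intro Collect_cong conj_cong refl)
    fix M assume M: "partition_on V M" "\<forall>e\<in>M. card e = 2"
    then have "\<forall>e\<in>M. e \<subseteq> V" by (auto simp: partition_on_def)
    then show "pairwise (\<lambda>e e'. convex hull (f ` e) \<inter> convex hull (f ` e') = {}) M =
      pairwise (\<lambda>e e'. convex hull (g ` e) \<inter> convex hull (g ` e') = {}) M"
      unfolding pairwise_def using hull M(2) by metis
  qed
  have inj: "inj_on ((`) ((`) h)) F" if "inj_on h V" for h :: "'a \<Rightarrow> 'c"
  proof -
    have "F \<subseteq> Pow (Pow V)"
      by (auto simp: F_def R_def partition_on_def)
    then show ?thesis
      using that by (meson inj_on_image_Pow inj_on_subset)
  qed
  have inj': "inj_on ((`) ((`) h)) F" if "inj_on h V" for h :: "'a \<Rightarrow> 'b"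
  proof -
    have "F \<subseteq> Pow (Pow V)"
      by (auto simp: F_def R_def partition_on_def)
    then show ?thesis
      using that by (meson inj_on_image_Pow inj_on_subset)
  qed
  have "card (crossing_free_pairings (f ` V)) = card F"
    using crossing_free_pairings_image[OF f] card_image[OF inj'[OF f]]
    by (simp add: F_def R_def)
  moreover have "card (crossing_free_pairings (g ` V)) = card F"
    using crossing_free_pairings_image[OF g] card_image[OF inj[OF g]]
    by (simp add: \<open>F = G\<close> G_def R_def)
  ultimately show ?thesis by simp
qed

definition place :: "(nat \<Rightarrow> real) \<Rightarrow> (nat \<Rightarrow> real) \<Rightarrow> nat + nat \<Rightarrow> real \<times> real" where
  "place x y = case_sum (\<lambda>i. (x i, 0)) (\<lambda>j. (y j, 1))"

lemma segments_disjoint_same_line: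
  fixes a b c d h :: real
  shows "convex hull {(a, h), (b, h)} \<inter> convex hull {(c, h), (d, h)} = {} \<longleftrightarrow>
    (a < c \<and> a < d \<and> b < c \<and> b < d) \<or> (c < a \<and> d < a \<and> c < b \<and> d < b)"
proof -
  have "convex hull {(a, h), (b, h)} \<inter> convex hull {(c, h), (d, h)} = {} \<longleftrightarrow>
      closed_segment a b \<inter> closed_segment c d = {}"
    unfolding segment_convex_hull[symmetric] by (auto simp: closed_segment_same_snd)
  also have "\<dots> \<longleftrightarrow> (a < c \<and> a < d \<and> b < c \<and> b < d) \<or> (c < a \<and> d < a \<and> c < b \<and> d < b)"
    by (simp add: closed_segment_eq_real_ivl min_def max_def) argo
  finally show ?thesis .
qed

lemma segments_disjoint_two_lines:
  fixes a b c d h h' :: real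
  assumes "h \<noteq> h'"
  shows "convex hull {(a, h), (b, h)} \<inter> convex hull {(c, h'), (d, h')} = {}"
  using assms by (auto simp: segment_convex_hull[symmetric] closed_segment_same_snd)

lemma segments_disjoint_cross:
  fixes a b c d h h' :: real
  assumes "h \<noteq> h'"
  shows "convex hull {(a, h), (b, h)} \<inter> convex hull {(c, h), (d, h')} = {} \<longleftrightarrow>
    (c < a \<and> c < b) \<or> (a < c \<and> b < c)"
proof -
  have "p = (c, h)" if "p \<in> closed_segment (c, h) (d, h')" "snd p = h" for p
  proof -
    from that(1) obtain u where u: "p = (1 - u) *\<^sub>R (c, h) + u *\<^sub>R (d, h')"
      unfolding in_segment by blast
    with that(2) have "u * (h' - h) = 0" by (simp add: algebra_simps)
    with assms u show ?thesis by simp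
  qed
  moreover have "(c, h) \<in> closed_segment (c, h) (d, h')" by simp
  moreover have "closed_segment (a, h) (b, h) = (\<lambda>t. (t, h)) ` closed_segment a b"
    by (auto simp: closed_segment_same_snd)
  ultimately have "convex hull {(a, h), (b, h)} \<inter> convex hull {(c, h), (d, h')} = {} \<longleftrightarrow>
      c \<notin> closed_segment a b"
    unfolding segment_convex_hull[symmetric] by force
  then show ?thesis
    by (auto simp: closed_segment_eq_real_ivl)
qed

lemma segments_disjoint_cross_cross:
  fixes a b c d :: real
  shows "convex hull {(a, 0), (b, 1::real)} \<inter> convex hull {(c, 0), (d, 1)} = {} \<longleftrightarrow>
    (a < c \<and> b < d) \<or> (c < a \<and> d < b)"
proof -
  have mem: "(s, t) \<in> closed_segment (a, 0) (b, 1) \<longleftrightarrow> 0 \<le> t \<and> t \<le> 1 \<and> s = (1 - t) * a + t * b"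
    for s t a b :: real
    by (auto simp: in_segment)
  have "convex hull {(a, 0), (b, 1::real)} \<inter> convex hull {(c, 0), (d, 1)} = {} \<longleftrightarrow>
      (\<forall>t. 0 \<le> t \<and> t \<le> 1 \<longrightarrow> (1 - t) * a + t * b \<noteq> (1 - t) * c + t * d)"
    unfolding segment_convex_hull[symmetric] by (auto simp: set_eq_iff mem)
  also have "\<dots> \<longleftrightarrow> (a < c \<and> b < d) \<or> (c < a \<and> d < b)"
  proof
    assume L: "\<forall>t. 0 \<le> t \<and> t \<le> 1 \<longrightarrow> (1 - t) * a + t * b \<noteq> (1 - t) * c + t * d"
    have ne: "a \<noteq> c" "b \<noteq> d" using L[rule_format, of 0] L[rule_format, of 1] by auto
    show "(a < c \<and> b < d) \<or> (c < a \<and> d < b)"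
    proof (rule ccontr)
      assume "\<not> ?thesis"
      with ne have opp: "(a < c \<and> d < b) \<or> (c < a \<and> b < d)" by auto
      define t where "t = (a - c) / ((a - c) - (b - d))"
      have nz: "(a - c) - (b - d) \<noteq> 0" using opp by auto
      have "0 \<le> t" "t \<le> 1" using opp by (auto simp: t_def divide_simps)
      moreover have "t * ((a - c) - (b - d)) = a - c" using nz by (simp add: t_def)
      then have "(1 - t) * a + t * b = (1 - t) * c + t * d" by (simp add: algebra_simps)
      ultimately show False using L by blast
    qed
  next
    assume R: "(a < c \<and> b < d) \<or> (c < a \<and> d < b)"
    have lt: "(1 - t) * a + t * b < (1 - t) * c + t * d"
      if "a < c" "b < d" "0 \<le> t" "t \<le> 1" for a b c d t :: real
    proof (cases "t = 1")
      case False
      then have "(1 - t) * a < (1 - t) * c" using that by simp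
      moreover have "t * b \<le> t * d" using that by (simp add: mult_left_mono)
      ultimately show ?thesis by simp
    qed (use that in simp)
    show "\<forall>t. 0 \<le> t \<and> t \<le> 1 \<longrightarrow> (1 - t) * a + t * b \<noteq> (1 - t) * c + t * d"
      using R lt[of a c b d] lt[of c a d b] by (metis less_irrefl)
  qed
  finally show ?thesis .
qed

lemma inj_on_place:
  assumes "strict_mono_on {..<p} x" "strict_mono_on {..<q} y"
  shows "inj_on (place x y) ({..<p} <+> {..<q})"
  using strict_mono_on_imp_inj_on[OF assms(1)] strict_mono_on_imp_inj_on[OF assms(2)]
  by (auto simp: inj_on_def place_def)

lemma place_image:
  "place x y ` ({..<p} <+> {..<q}) = (\<lambda>i. (x i, 0)) ` {..<p} \<union> (\<lambda>j. (y j, 1)) ` {..<q}"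
  by (simp add: place_def Plus_def image_Un image_image)

lemma place_disjoint_iff:
  assumes x: "strict_mono_on {..<p} x" and y: "strict_mono_on {..<q} y"
    and e: "e \<subseteq> {..<p} <+> {..<q}" "card e = 2" and e': "e' \<subseteq> {..<p} <+> {..<q}" "card e' = 2"
  shows "convex hull (place x y ` e) \<inter> convex hull (place x y ` e') = {} \<longleftrightarrow>
    convex hull (place real real ` e) \<inter> convex hull (place real real ` e') = {}"
proof -
  have x_less: "x i < x j \<longleftrightarrow> i < j" if "i < p" "j < p" for i j
    using strict_mono_on_less[OF x] that by simp
  have y_less: "y i < y j \<longleftrightarrow> i < j" if "i < q" "j < q" for i j
    using strict_mono_on_less[OF y] that by simp
  have shape: "(\<exists>i j. i < p \<and> j < p \<and> e = {Inl i, Inl j}) \<or>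
      (\<exists>i j. i < q \<and> j < q \<and> e = {Inr i, Inr j}) \<or>
      (\<exists>i j. i < p \<and> j < q \<and> e = {Inl i, Inr j})"
    if "e \<subseteq> {..<p} <+> {..<q}" "card e = 2" for e
  proof -
    from that(2) obtain s t where "e = {s, t}" by (auto simp: card_2_iff)
    with that(1) show ?thesis by (cases s; cases t) (auto simp: insert_commute)
  qed
  note two = segments_disjoint_two_lines[of 0 1, simplified]
    segments_disjoint_two_lines[of 1 0, simplified]
  note cross = segments_disjoint_cross[of 0 1, simplified]
    segments_disjoint_cross[of 0 1, simplified, THEN trans[OF arg_cong[OF Int_commute, of "\<lambda>A. A = {}"]]]
    segments_disjoint_cross[of 1 0, simplified, unfolded insert_commute[of "(_, 1)" "(_, 0)"]]
    segments_disjoint_cross[of 1 0, simplified, unfolded insert_commute[of "(_, 1)" "(_, 0)"],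
      THEN trans[OF arg_cong[OF Int_commute, of "\<lambda>A. A = {}"]]]
  show ?thesis
    using shape[OF e] shape[OF e']
    by (elim disjE exE conjE)
      (simp_all add: place_def x_less y_less segments_disjoint_same_line two cross
        segments_disjoint_cross_cross)
qed

theorem card_crossing_free_pairings_eq_a_num:
  fixes u v w :: "'a::real_vector"
  assumes x: "strict_mono_on {..<p} x" and y: "strict_mono_on {..<q} y"
    and v: "v \<noteq> 0" and parallel: "w - u \<notin> span {v}"
  shows "card (crossing_free_pairings
      ((\<lambda>i. u + x i *\<^sub>R v) ` {..<p} \<union> (\<lambda>j. w + y j *\<^sub>R v) ` {..<q})) = a_num p q"
proof -
  define V where "V = {..<p} <+> {..<q}"
  define L where "L = (\<lambda>(s, t). s *\<^sub>R v + t *\<^sub>R (w - u))"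
  have L: "linear L"
    by (auto simp: L_def linear_iff algebra_simps)
  have zero: "s = 0 \<and> t = 0" if st: "s *\<^sub>R v + t *\<^sub>R (w - u) = 0" for s t
  proof -
    have "t = 0"
    proof (rule ccontr)
      assume "t \<noteq> 0"
      have "t *\<^sub>R (w - u) = (- s) *\<^sub>R v" using st by (simp add: add_eq_0_iff)
      then have "(1 / t) *\<^sub>R (t *\<^sub>R (w - u)) = (1 / t) *\<^sub>R ((- s) *\<^sub>R v)" by (rule arg_cong)
      then have "w - u = (- s / t) *\<^sub>R v"
        using \<open>t \<noteq> 0\<close> by simp
      with parallel show False by (metis span_base span_scale singletonI)
    qed
    with st v show ?thesis by simp
  qed
  have "inj L"
    by (rule linear_injective_0[OF L, THEN iffD2]) (auto simp: L_def zero_prod_def dest: zero)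
  define g where "g = (\<lambda>z. u + L z)"
  have "inj g" using \<open>inj L\<close> by (auto simp: g_def inj_def)
  have hull_g: "convex hull (g ` S) = g ` (convex hull S)" for S
  proof -
    have "g ` S = (+) u ` (L ` S)" for S by (auto simp: g_def)
    then show ?thesis
      by (simp add: convex_hull_translation convex_hull_linear_image[OF L])
  qed
  have "(\<lambda>i. u + x i *\<^sub>R v) ` {..<p} \<union> (\<lambda>j. w + y j *\<^sub>R v) ` {..<q} = g ` (place x y ` V)"
    unfolding V_def place_image image_Un image_image by (simp add: g_def L_def algebra_simps)
  also have "card (crossing_free_pairings \<dots>) = card (crossing_free_pairings (place x y ` V))"
  proof -
    have "card (crossing_free_pairings (g ` (place x y ` V))) =
        card (crossing_free_pairings (id ` (place x y ` V)))"
    proof (rule card_crossing_free_pairings_cong)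
      show "inj_on g (place x y ` V)" using \<open>inj g\<close> by (rule inj_on_subset) simp
      show "convex hull (g ` e) \<inter> convex hull (g ` e') = {} \<longleftrightarrow>
          convex hull (id ` e) \<inter> convex hull (id ` e') = {}" for e e'
        unfolding hull_g using image_Int[OF \<open>inj g\<close>, symmetric] by simp
    qed simp
    then show ?thesis by simp
  qed
  also have "\<dots> = card (crossing_free_pairings (place real real ` V))"
  proof (rule card_crossing_free_pairings_cong)
    show "inj_on (place x y) V" "inj_on (place real real) V"
      unfolding V_def using x y by (auto intro!: inj_on_place simp: strict_mono_on_def)
  qed (use place_disjoint_iff[OF x y] in \<open>simp add: V_def\<close>)
  also have "place real real ` V = marked_points p q"
    by (simp add: V_def place_image marked_points_def)
  finally show ?thesis by (simp add: a_num_def)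
qed

end

theory Submission
  imports Defs
begin

text \<open>
  Two points of one line can only be paired if they are neighbours, and the remaining points are
  joined across the strip in increasing order. A crossing-free pairing is therefore the same as a
  pair of segment choices \<open>(S, T)\<close> leaving equally many free points on the two lines. For lines
  with \<open>n\<close> points each, both this condition (\<open>n - 2 |S| = n - 2 |T|\<close>) and the equality of the
  numbers of objects (\<open>n - |S| = n - |T|\<close>) say that \<open>|S| = |T|\<close>.
\<close>

section \<open>Ranks in finite sets and order-preserving matchings\<close>

definition rank_in :: "nat set \<Rightarrow> nat \<Rightarrow> nat" where
  "rank_in A i = card (A \<inter> {..<i})"

lemma rank_in_less:
  assumes "finite A" "i \<in> A" "i < j"
  shows "rank_in A i < rank_in A j"
  unfolding rank_in_def using assms by (intro psubset_card_mono) auto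

lemma rank_in_eq_iff:
  assumes "finite A" "i \<in> A" "j \<in> A"
  shows "rank_in A i = rank_in A j \<longleftrightarrow> i = j"
  using rank_in_less[OF assms(1)] assms(2,3) by (metis less_irrefl linorder_neqE_nat)

lemma rank_in_less_iff:
  assumes "finite A" "i \<in> A" "j \<in> A"
  shows "rank_in A i < rank_in A j \<longleftrightarrow> i < j"
  using rank_in_less[OF assms(1)] assms(2,3) by (metis less_asym less_irrefl linorder_neqE_nat)

text \<open>An element does not count towards its own rank, so ranks of members stay below the
  cardinality. Being injective on \<open>A\<close>, the rank map fills this range.\<close>

lemma rank_in_image:
  assumes "finite A"
  shows "rank_in A ` A = {..<card A}"
proof (rule card_subset_eq)
  show "rank_in A ` A \<subseteq> {..<card A}"
    unfolding rank_in_def using assms by (auto intro!: psubset_card_mono)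
  show "card (rank_in A ` A) = card {..<card A}"
    using rank_in_eq_iff[OF assms] by (simp add: card_image inj_on_def)
qed simp

text \<open>The order condition makes \<open>C\<close> the graph of an increasing bijection. Such a
  map carries the elements below \<open>i\<close> onto the elements below the partner of
  \<open>i\<close>, so partners have equal rank. Hence the two sets alone determine
  \<open>C\<close>.\<close>

lemma monotone_matching:
  assumes fin: "finite A" "finite B"
    and total: "\<And>i. i \<in> A \<Longrightarrow> \<exists>j\<in>B. C i j" "\<And>j. j \<in> B \<Longrightarrow> \<exists>i\<in>A. C i j"
    and mono: "\<And>i j i' j'. C i j \<Longrightarrow> C i' j' \<Longrightarrow> i < i' \<longleftrightarrow> j < j'"
  shows "card A = card B" and "\<And>i j. i \<in> A \<Longrightarrow> j \<in> B \<Longrightarrow> C i j \<longleftrightarrow> rank_in A i = rank_in B j"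
proof -
  obtain f where f: "\<And>i. i \<in> A \<Longrightarrow> f i \<in> B \<and> C i (f i)"
    using total(1) by metis
  \<comment> \<open>If \<open>i\<close> had two partners, one would be smaller than the other, and
    \<open>mono\<close> would give \<open>i < i\<close>.\<close>
  have C_iff: "C i j \<longleftrightarrow> j = f i" if "i \<in> A" for i j
    using f[OF that] mono by (metis less_irrefl linorder_neqE_nat)
  have less: "f i < f i' \<longleftrightarrow> i < i'" if "i \<in> A" "i' \<in> A" for i i'
    using f that mono by blast
  have inj: "inj_on f A"
    by (rule inj_onI) (metis less less_irrefl linorder_neqE_nat)
  have im: "f ` A = B"
    using f total(2) C_iff by blast
  show "card A = card B"
    using card_image[OF inj] im by simp
  have rank_f: "rank_in B (f i) = rank_in A i" if "i \<in> A" for i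
  proof -
    have "B \<inter> {..<f i} = f ` (A \<inter> {..<i})"
      using im less that by auto
    then show ?thesis
      unfolding rank_in_def using inj by (metis card_image inf_le1 inj_on_subset)
  qed
  show "C i j \<longleftrightarrow> rank_in A i = rank_in B j" if "i \<in> A" "j \<in> B" for i j
    using that C_iff rank_f rank_in_eq_iff[OF fin(2)] f by metis
qed

section \<open>Disjointness of segments between labelled points\<close>

definition apart :: "(nat + nat) set \<Rightarrow> (nat + nat) set \<Rightarrow> bool" where
  "apart e f \<longleftrightarrow> convex hull (place real real ` e) \<inter> convex hull (place real real ` f) = {}"

lemma apart_commute: "apart e f \<longleftrightarrow> apart f e"
  by (simp add: apart_def Int_commute)

lemma apart_imp_disjoint: "apart e f \<Longrightarrow> e \<inter> f = {}"
  unfolding apart_def by (meson disjoint_iff hull_inc imageI)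

text \<open>A segment inside a line contains every marked point between its endpoints; this rules
  out pairing two points of one line that are not neighbours. The variable \<open>L\<close> lets one
  statement serve both lines.\<close>

lemma not_apart_between:
  assumes L: "L = Inl \<or> L = Inr" and "i \<le> m" "m \<le> j" "L m \<in> f"
  shows "\<not> apart {L i, L j} f"
proof -
  have "place real real (L m) \<in> closed_segment (place real real (L i)) (place real real (L j))"
    using assms by (auto simp: place_def closed_segment_same_snd closed_segment_eq_real_ivl)
  then have "place real real (L m) \<in> convex hull (place real real ` {L i, L j})"
    by (simp add: segment_convex_hull)
  moreover have "place real real (L m) \<in> convex hull (place real real ` f)"
    using assms by (simp add: hull_inc)
  ultimately show ?thesis
    unfolding apart_def by blast
qed

text \<open>Two pairs of consecutive integers without a common element lie one entirely before the
  other.\<close>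

lemma apart_same_line:
  assumes "L = Inl \<or> L = Inr" "{i, Suc i} \<inter> {j, Suc j} = {}"
  shows "apart {L i, L (Suc i)} {L j, L (Suc j)}"
proof -
  have "Suc i < j \<or> Suc j < i"
    using assms(2) by auto
  with assms(1) show ?thesis
    by (elim disjE) (simp_all add: apart_def place_def segments_disjoint_same_line)
qed

lemma apart_two_lines: "apart {Inl i, Inl i'} {Inr j, Inr j'}"
  by (simp add: apart_def place_def segments_disjoint_two_lines)

text \<open>No integer lies strictly between \<open>i\<close> and \<open>Suc i\<close>, so
  \<open>c\<close> lies strictly to one side of both, and a segment across the strip meets the first
  line only at its endpoint \<open>c\<close>.\<close>

lemma apart_cross_Inl:
  assumes "c \<notin> {i, Suc i}"
  shows "apart {Inl i, Inl (Suc i)} {Inl c, Inr d}"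
  using assms by (auto simp: apart_def place_def segments_disjoint_cross)

lemma apart_cross_Inr:
  assumes "d \<notin> {i, Suc i}"
  shows "apart {Inr i, Inr (Suc i)} {Inl c, Inr d}"
proof -
  \<comment> \<open>\<open>segments_disjoint_cross\<close> expects the endpoint on the shared line
    first.\<close>
  have "apart {Inr i, Inr (Suc i)} {Inr d, Inl c}"
    using assms by (auto simp: apart_def place_def segments_disjoint_cross)
  then show ?thesis
    by (simp add: insert_commute)
qed

lemma apart_cross_cross:
  "apart {Inl i, Inr j} {Inl i', Inr j'} \<longleftrightarrow> (i < i' \<and> j < j') \<or> (i' < i \<and> j' < j)"
  by (simp add: apart_def place_def segments_disjoint_cross_cross)

section \<open>Crossing-free pairings of labels instead of points of the plane\<close>

definition pairings :: "nat \<Rightarrow> nat \<Rightarrow> (nat + nat) set set set" where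
  "pairings p q = {M. partition_on ({..<p} <+> {..<q}) M \<and> (\<forall>e\<in>M. card e = 2) \<and>
     pairwise apart M}"

lemma pairingsD:
  assumes "M \<in> pairings p q"
  shows "\<Union>M = {..<p} <+> {..<q}" and "\<And>e. e \<in> M \<Longrightarrow> card e = 2"
    and "\<And>e f. e \<in> M \<Longrightarrow> f \<in> M \<Longrightarrow> e \<noteq> f \<Longrightarrow> apart e f" and "disjoint M"
proof -
  have "partition_on ({..<p} <+> {..<q}) M" and two: "\<forall>e\<in>M. card e = 2" and pw: "pairwise apart M"
    using assms unfolding pairings_def by simp_all
  then show "\<Union>M = {..<p} <+> {..<q}" "disjoint M"
    unfolding partition_on_def by simp_all
  show "card e = 2" if "e \<in> M" for e
    using two that by (rule bspec)
  show "apart e f" if "e \<in> M" "f \<in> M" "e \<noteq> f" for e f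
    using pw that by (rule pairwiseD)
qed

text \<open>The placement of the labels is injective, hence so is the map it induces on families of
  sets, and counting may be done on labels.\<close>

lemma a_num_eq_card_pairings: "a_num p q = card (pairings p q)"
proof -
  let ?V = "{..<p} <+> {..<q}"
  have inj: "inj_on (place real real) ?V"
    by (intro inj_on_place) (auto simp: strict_mono_on_def)
  have "pairings p q \<subseteq> Pow (Pow ?V)"
    by (auto simp: pairings_def partition_on_def)
  then have inj2: "inj_on ((`) ((`) (place real real))) (pairings p q)"
    using inj by (meson inj_on_image_Pow inj_on_subset)
  have "marked_points p q = place real real ` ?V"
    by (simp add: place_image marked_points_def)
  then have "crossing_free_pairings (marked_points p q) =
      (`) ((`) (place real real)) ` pairings p q"
    by (simp add: crossing_free_pairings_image[OF inj] pairings_def apart_def[abs_def])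
  then show ?thesis
    unfolding a_num_def using card_image[OF inj2] by simp
qed

section \<open>Free points and objects of a segment choice\<close>

definition free_points :: "nat \<Rightarrow> nat set set \<Rightarrow> nat set" where
  "free_points k S = {..<k} - \<Union>S"

lemma finite_free_points: "finite (free_points k S)"
  by (simp add: free_points_def)

lemma segment_choice_elem:
  assumes "S \<in> segment_choices k" "s \<in> S"
  shows "\<exists>i. s = {i, Suc i} \<and> Suc i < k"
  using assms by (auto simp: segment_choices_def neighbour_segments_def)

lemma segment_choice_disjoint:
  assumes "S \<in> segment_choices k" "s \<in> S" "t \<in> S" "s \<noteq> t"
  shows "s \<inter> t = {}"
  using assms by (auto simp: segment_choices_def disjoint_def)

text \<open>The chosen segments are disjoint and have two points each, so they cover
  \<open>2 * card S\<close> points. The bound by \<open>k\<close> ensures that the subtractions are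
  not truncated.\<close>

lemma segment_choice_card:
  assumes S: "S \<in> segment_choices k"
  shows "card (free_points k S) = k - 2 * card S" "2 * card S \<le> k"
    "card (objects k S) = k - card S"
proof -
  have sub: "\<Union>S \<subseteq> {..<k}"
  proof
    fix x assume "x \<in> \<Union>S"
    then obtain s where "s \<in> S" "x \<in> s" by blast
    with segment_choice_elem[OF S] show "x \<in> {..<k}" by fastforce
  qed
  have two: "finite s \<and> card s = 2" if "s \<in> S" for s
    using segment_choice_elem[OF S that] by auto
  have "finite S"
    using sub by (meson finite_UnionD finite_lessThan finite_subset)
  have "card (\<Union>S) = sum card S"
    using S two by (intro card_Union_disjoint) (auto simp: segment_choices_def)
  also have "\<dots> = sum (\<lambda>_. 2) S"
    using two by (intro sum.cong) auto
  finally have card: "card (\<Union>S) = 2 * card S"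
    by simp
  show le: "2 * card S \<le> k"
    using card_mono[OF finite_lessThan sub] card by simp
  show free: "card (free_points k S) = k - 2 * card S"
    unfolding free_points_def using card_Diff_subset[OF finite_subset[OF sub] sub] card by simp
  have "card (objects k S) = card S + card (free_points k S)"
    unfolding objects_def free_points_def using \<open>finite S\<close> by (simp add: card_Plus)
  with free le show "card (objects k S) = k - card S"
    by simp
qed

section \<open>The bijection between pairings and pairs of segment choices\<close>

definition join :: "nat \<Rightarrow> nat \<Rightarrow> nat set set \<times> nat set set \<Rightarrow> (nat + nat) set set" where
  "join p q = (\<lambda>(S, T). (`) Inl ` S \<union> (`) Inr ` T \<union>
     {{Inl i, Inr j} |i j. i \<in> free_points p S \<and> j \<in> free_points q T \<and>
        rank_in (free_points p S) i = rank_in (free_points q T) j})"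

text \<open>The intended inverse of \<open>join\<close>. Segments across the strip are dropped:
  their endpoints are the free points, and disjointness forces the \<open>r\<close>-th free point of
  one line to go to the \<open>r\<close>-th of the other.\<close>

definition split :: "(nat + nat) set set \<Rightarrow> nat set set \<times> nat set set" where
  "split M = ({s. Inl ` s \<in> M}, {t. Inr ` t \<in> M})"

text \<open>The balance is imposed on free points and not on objects, because each segment across
  the strip uses one free point of each line. In this form the bijection holds for all
  \<open>p\<close> and \<open>q\<close>.\<close>

definition balanced_choices :: "nat \<Rightarrow> nat \<Rightarrow> (nat set set \<times> nat set set) set" where
  "balanced_choices p q = {(S, T). S \<in> segment_choices p \<and> T \<in> segment_choices q \<and>
     card (free_points p S) = card (free_points q T)}"

text \<open>If a pair inside a line skipped a point, that point would lie on the segment of the pair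
  and also belong to another block, so two segments would meet. The two cases of \<open>L\<close>
  cover both lines.\<close>

lemma pairing_split_line:
  assumes M: "M \<in> pairings p q" and L: "L = Inl \<and> k = p \<or> L = Inr \<and> k = q"
  shows "{s. L ` s \<in> M} \<in> segment_choices k"
proof -
  have L': "L = Inl \<or> L = Inr" and inj: "inj L" using L by auto
  note union = pairingsD(1)[OF M] and two = pairingsD(2)[OF M]
    and pw = pairingsD(3)[OF M] and disj = pairingsD(4)[OF M]
  have neighbours: "{i, j} \<in> neighbour_segments k" if e: "{L i, L j} \<in> M" and "i < j" for i j
  proof -
    have "L j \<in> \<Union>M" using e by blast
    then have "j < k" unfolding union using L by auto
    moreover have "j = Suc i"
    proof (rule ccontr)
      assume "j \<noteq> Suc i"
      then have "Suc i < j" using \<open>i < j\<close> by simp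
      then have "L (Suc i) \<in> \<Union>M" unfolding union using L \<open>j < k\<close> by auto
      then obtain f where f: "f \<in> M" "L (Suc i) \<in> f" by blast
      have "L (Suc i) \<notin> {L i, L j}"
        using \<open>Suc i < j\<close> inj by (auto simp: inj_eq)
      with f have "{L i, L j} \<noteq> f" by blast
      with e f(1) have "apart {L i, L j} f" by (rule pw)
      with not_apart_between[OF L' _ _ f(2), of i j] \<open>Suc i < j\<close> show False by simp
    qed
    ultimately show ?thesis by (auto simp: neighbour_segments_def)
  qed
  have "s \<in> neighbour_segments k" if "L ` s \<in> M" for s
  proof -
    have "card s = 2"
      using two[OF that] by (simp add: card_image inj_on_subset[OF inj])
    then obtain i j where ij: "s = {i, j}" "i \<noteq> j" by (auto simp: card_2_iff)
    \<comment> \<open>Both orders are recorded because \<open>neighbours\<close> asks for the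
      smaller point first.\<close>
    then have "{L i, L j} \<in> M" "{L j, L i} \<in> M"
      using that by (simp_all add: insert_commute)
    then show ?thesis
      using neighbours[of i j] neighbours[of j i] ij by (metis insert_commute linorder_neqE_nat)
  qed
  moreover have "s \<inter> t = {}" if "L ` s \<in> M" "L ` t \<in> M" "s \<noteq> t" for s t
  proof -
    have "L ` s \<noteq> L ` t"
      using \<open>s \<noteq> t\<close> inj by (simp add: inj_image_eq_iff)
    then have "L ` s \<inter> L ` t = {}"
      by (rule disjointD[OF disj that(1,2)])
    then show ?thesis by blast
  qed
  ultimately show ?thesis
    by (auto simp: segment_choices_def disjoint_def)
qed

text \<open>A block lies inside one line or crosses the strip. The crossing blocks match the free
  points of the two lines, in increasing order since they are disjoint, so
  \<open>monotone_matching\<close> identifies them with the pairs of equal rank that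
  \<open>join\<close> uses.\<close>

lemma pairing_split:
  assumes M: "M \<in> pairings p q"
  shows "split M \<in> balanced_choices p q" and "join p q (split M) = M"
proof -
  define S T where "S = {s. Inl ` s \<in> M}" and "T = {t. Inr ` t \<in> M}"
  define A B where "A = free_points p S" and "B = free_points q T"
  define C where "C i j \<longleftrightarrow> {Inl i, Inr j} \<in> M" for i j
  note union = pairingsD(1)[OF M] and two = pairingsD(2)[OF M]
    and pw = pairingsD(3)[OF M] and disj = pairingsD(4)[OF M]
  have S: "S \<in> segment_choices p" and T: "T \<in> segment_choices q"
    unfolding S_def T_def
    using pairing_split_line[OF M, of Inl p] pairing_split_line[OF M, of Inr q] by simp_all
  have shape: "(\<exists>s\<in>S. e = Inl ` s) \<or> (\<exists>t\<in>T. e = Inr ` t) \<or> (\<exists>i j. C i j \<and> e = {Inl i, Inr j})"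
    if "e \<in> M" for e
  proof -
    obtain x y where e: "e = {x, y}" using two[OF \<open>e \<in> M\<close>] by (auto simp: card_2_iff)
    show ?thesis
    proof (cases x; cases y)
      fix i j assume "x = Inl i" "y = Inl j"
      then have "e = Inl ` {i, j}" using e by simp
      moreover from this that have "{i, j} \<in> S" by (simp add: S_def)
      ultimately show ?thesis by blast
    next
      fix i j assume "x = Inr i" "y = Inr j"
      then have "e = Inr ` {i, j}" using e by simp
      moreover from this that have "{i, j} \<in> T" by (simp add: T_def)
      ultimately show ?thesis by blast
    qed (use that e in \<open>auto simp: C_def insert_commute\<close>)
  qed
  have C_free: "i \<in> A \<and> j \<in> B" if "C i j" for i j
  proof -
    have e: "{Inl i, Inr j} \<in> M" using that by (simp add: C_def)
    then have "{Inl i, Inr j} \<subseteq> \<Union>M" by (rule Union_upper)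
    then have "i < p" "j < q" unfolding union by auto
    moreover have "i \<notin> s" if "s \<in> S" for s
      using disjointD[OF disj e, of "Inl ` s"] that by (auto simp: S_def)
    moreover have "j \<notin> t" if "t \<in> T" for t
      using disjointD[OF disj e, of "Inr ` t"] that by (auto simp: T_def)
    ultimately show ?thesis by (auto simp: A_def B_def free_points_def)
  qed
  \<comment> \<open>The block of a free point belongs neither to \<open>S\<close> nor to the other
    line, so it crosses the strip.\<close>
  have total: "\<exists>j\<in>B. C i j" if "i \<in> A" for i
  proof -
    have "Inl i \<in> \<Union>M" unfolding union using that by (auto simp: A_def free_points_def)
    then obtain e where "e \<in> M" "Inl i \<in> e" by blast
    with shape[of e] that have "\<exists>j. C i j" by (auto simp: A_def free_points_def)
    with C_free show ?thesis by blast
  qed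
  have total': "\<exists>i\<in>A. C i j" if "j \<in> B" for j
  proof -
    have "Inr j \<in> \<Union>M" unfolding union using that by (auto simp: B_def free_points_def)
    then obtain e where "e \<in> M" "Inr j \<in> e" by blast
    with shape[of e] that have "\<exists>i. C i j" by (auto simp: B_def free_points_def)
    with C_free show ?thesis by blast
  qed
  have mono: "i < i' \<longleftrightarrow> j < j'" if "C i j" "C i' j'" for i j i' j'
  proof (cases "i = i' \<and> j = j'")
    case False
    then have "{Inl i, Inr j} \<noteq> {Inl i', Inr j'}" by (auto simp: doubleton_eq_iff)
    with that have "apart {Inl i, Inr j} {Inl i', Inr j'}"
      unfolding C_def by (intro pw)
    then show ?thesis by (auto simp: apart_cross_cross)
  qed simp
  have fin: "finite A" "finite B" by (simp_all add: A_def B_def finite_free_points)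
  note matching = monotone_matching[OF fin total total' mono]
  show "split M \<in> balanced_choices p q"
    using S T matching(1) by (simp add: split_def balanced_choices_def A_def B_def S_def T_def)
  have "join p q (split M) =
      (`) Inl ` S \<union> (`) Inr ` T \<union>
       {{Inl i, Inr j} |i j. i \<in> A \<and> j \<in> B \<and> rank_in A i = rank_in B j}"
    by (simp add: join_def split_def A_def B_def S_def T_def)
  also have "\<dots> = (`) Inl ` S \<union> (`) Inr ` T \<union> {{Inl i, Inr j} |i j. C i j}"
  proof -
    have "i \<in> A \<and> j \<in> B \<and> rank_in A i = rank_in B j \<longleftrightarrow> C i j" for i j
      using matching(2) C_free by metis
    then show ?thesis by simp
  qed
  also have "\<dots> = M"
  proof (intro equalityI subsetI)
    fix e assume "e \<in> M"
    with shape[of e] show "e \<in> (`) Inl ` S \<union> (`) Inr ` T \<union> {{Inl i, Inr j} |i j. C i j}"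
      by blast
  qed (auto simp: S_def T_def C_def)
  finally show "join p q (split M) = M" .
qed

lemma split_join:
  assumes S: "S \<in> segment_choices p" and T: "T \<in> segment_choices q"
  shows "split (join p q (S, T)) = (S, T)"
proof -
  \<comment> \<open>The empty set is the only set whose images under \<open>Inl\<close> and
    \<open>Inr\<close> can coincide; excluding it keeps the three kinds of blocks
    distinguishable.\<close>
  have nonempty: "{} \<notin> S" "{} \<notin> T"
    using segment_choice_elem[OF S] segment_choice_elem[OF T] by blast+
  have Inl: "Inl ` s \<noteq> {Inl i, Inr j}" and Inr: "Inr ` s \<noteq> {Inl i, Inr j}"
    for s :: "nat set" and i j :: nat
    by (auto dest: equalityD2)
  have mixed: "Inl ` s = Inr ` t \<longleftrightarrow> s = {} \<and> t = {}" "Inr ` t = Inl ` s \<longleftrightarrow> s = {} \<and> t = {}"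
    for s t :: "nat set"
    by auto
  show ?thesis
    unfolding split_def join_def
    using nonempty by (auto simp: Inl Inr mixed inj_image_eq_iff image_iff)
qed

text \<open>Disjointness is checked for each combination of the three kinds of segments. Every point
  is covered because equally many free points on the two lines have the same set of ranks, so each
  one finds a partner.\<close>

lemma join_mem_pairings:
  assumes "(S, T) \<in> balanced_choices p q"
  shows "join p q (S, T) \<in> pairings p q"
proof -
  define A B where "A = free_points p S" and "B = free_points q T"
  define X where "X = {{Inl i, Inr j} |i j. i \<in> A \<and> j \<in> B \<and> rank_in A i = rank_in B j}"
  have S: "S \<in> segment_choices p" and T: "T \<in> segment_choices q" and card: "card A = card B"
    using assms by (auto simp: balanced_choices_def A_def B_def)
  have fin: "finite A" "finite B" by (simp_all add: A_def B_def finite_free_points)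
  have J: "join p q (S, T) = (`) Inl ` S \<union> (`) Inr ` T \<union> X"
    by (simp add: join_def A_def B_def X_def)
  have SS: "apart (Inl ` s) (Inl ` t)" if st: "s \<in> S" "t \<in> S" "s \<noteq> t" for s t
  proof -
    obtain i j where "s = {i, Suc i}" "t = {j, Suc j}"
      using segment_choice_elem[OF S] st by metis
    then show ?thesis
      using segment_choice_disjoint[OF S st] apart_same_line[of Inl i j] by simp
  qed
  have TT: "apart (Inr ` s) (Inr ` t)" if st: "s \<in> T" "t \<in> T" "s \<noteq> t" for s t
  proof -
    obtain i j where "s = {i, Suc i}" "t = {j, Suc j}"
      using segment_choice_elem[OF T] st by metis
    then show ?thesis
      using segment_choice_disjoint[OF T st] apart_same_line[of Inr i j] by simp
  qed
  have ST: "apart (Inl ` s) (Inr ` t)" if st: "s \<in> S" "t \<in> T" for s t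
  proof -
    obtain i j where "s = {i, Suc i}" "t = {j, Suc j}"
      using segment_choice_elem[OF S st(1)] segment_choice_elem[OF T st(2)] by blast
    then show ?thesis
      using apart_two_lines by simp
  qed
  have SX: "apart (Inl ` s) e" if se: "s \<in> S" "e \<in> X" for s e
  proof -
    obtain i where i: "s = {i, Suc i}" using segment_choice_elem[OF S se(1)] by blast
    obtain c d where "e = {Inl c, Inr d}" "c \<in> A" using se(2) by (auto simp: X_def)
    \<comment> \<open>The endpoint \<open>c\<close> is free, hence differs from both ends of the
      chosen segment.\<close>
    with i se(1) show ?thesis
      using apart_cross_Inl[of c i d] by (auto simp: A_def free_points_def)
  qed
  have TX: "apart (Inr ` t) e" if te: "t \<in> T" "e \<in> X" for t e
  proof -
    obtain i where i: "t = {i, Suc i}" using segment_choice_elem[OF T te(1)] by blast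
    obtain c d where "e = {Inl c, Inr d}" "d \<in> B" using te(2) by (auto simp: X_def)
    with i te(1) show ?thesis
      using apart_cross_Inr[of d i c] by (auto simp: B_def free_points_def)
  qed
  have XX: "apart e f" if ef: "e \<in> X" "f \<in> X" "e \<noteq> f" for e f
  proof -
    obtain i j where e: "e = {Inl i, Inr j}" "i \<in> A" "j \<in> B" "rank_in A i = rank_in B j"
      using ef(1) by (auto simp: X_def)
    obtain i' j' where f: "f = {Inl i', Inr j'}" "i' \<in> A" "j' \<in> B" "rank_in A i' = rank_in B j'"
      using ef(2) by (auto simp: X_def)
    have less: "i < i' \<longleftrightarrow> j < j'" "i' < i \<longleftrightarrow> j' < j"
      using rank_in_less_iff[OF fin(1)] rank_in_less_iff[OF fin(2)] e f by metis+
    \<comment> \<open>If \<open>i = i'\<close>, then \<open>less\<close> leaves only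
      \<open>j = j'\<close>, so \<open>e\<close> and \<open>f\<close> would be equal.\<close>
    then have "i \<noteq> i'" using e(1) f(1) ef(3) by auto
    then show ?thesis
      using less e(1) f(1) by (auto simp: apart_cross_cross)
  qed
  have pw: "pairwise apart (join p q (S, T))"
  proof (rule pairwiseI)
    have cases: "(\<exists>s\<in>S. e = Inl ` s) \<or> (\<exists>t\<in>T. e = Inr ` t) \<or> e \<in> X"
      if "e \<in> join p q (S, T)" for e
      using that unfolding J by blast
    fix e f assume e: "e \<in> join p q (S, T)" and f: "f \<in> join p q (S, T)" and "e \<noteq> f"
    \<comment> \<open>Of the nine combinations of kinds, six are proved above and the others follow
      by symmetry.\<close>
    show "apart e f"
      using cases[OF e] cases[OF f] \<open>e \<noteq> f\<close>
      by (elim disjE bexE) (auto intro: SS TT ST SX TX XX apart_commute[THEN iffD1])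
  qed
  have two: "card e = 2 \<and> e \<subseteq> {..<p} <+> {..<q}" if e: "e \<in> join p q (S, T)" for e
  proof -
    consider s where "s \<in> S" "e = Inl ` s" | t where "t \<in> T" "e = Inr ` t" | "e \<in> X"
      using e unfolding J by blast
    then show ?thesis
    proof cases
      case 1
      moreover obtain i where "s = {i, Suc i}" "Suc i < p"
        using segment_choice_elem[OF S \<open>s \<in> S\<close>] by blast
      ultimately show ?thesis by auto
    next
      case 2
      moreover obtain i where "t = {i, Suc i}" "Suc i < q"
        using segment_choice_elem[OF T \<open>t \<in> T\<close>] by blast
      ultimately show ?thesis by auto
    next
      case 3
      then show ?thesis by (auto simp: X_def A_def B_def free_points_def)
    qed
  qed
  have cover: "Inl i \<in> \<Union>(join p q (S, T))" if "i < p" for i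
  proof (cases "i \<in> A")
    case True
    \<comment> \<open>Both sets of ranks are the same initial segment of the naturals, as
      \<open>card A = card B\<close>.\<close>
    then have "rank_in A i \<in> rank_in B ` B"
      using rank_in_image[OF fin(1)] rank_in_image[OF fin(2)] card by auto
    then obtain j where "j \<in> B" "rank_in A i = rank_in B j" by auto
    with True have "{Inl i, Inr j} \<in> X" by (auto simp: X_def)
    then show ?thesis by (auto simp: J)
  next
    case False
    with that show ?thesis by (auto simp: J A_def free_points_def)
  qed
  have cover': "Inr j \<in> \<Union>(join p q (S, T))" if "j < q" for j
  proof (cases "j \<in> B")
    case True
    then have "rank_in B j \<in> rank_in A ` A"
      using rank_in_image[OF fin(1)] rank_in_image[OF fin(2)] card by auto
    then obtain i where "i \<in> A" "rank_in A i = rank_in B j" by auto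
    with True have "{Inl i, Inr j} \<in> X" by (auto simp: X_def)
    then show ?thesis by (auto simp: J)
  next
    case False
    with that show ?thesis by (auto simp: J B_def free_points_def)
  qed
  have "partition_on ({..<p} <+> {..<q}) (join p q (S, T))"
  proof (rule partition_onI)
    show "\<Union>(join p q (S, T)) = {..<p} <+> {..<q}"
    proof (rule equalityI)
      show "\<Union>(join p q (S, T)) \<subseteq> {..<p} <+> {..<q}"
        using two by blast
      show "{..<p} <+> {..<q} \<subseteq> \<Union>(join p q (S, T))"
        using cover cover' by (intro subsetI, elim PlusE) simp_all
    qed
    \<comment> \<open>A label common to two blocks would place a common point on their
      segments.\<close>
    show "disjnt e f" if "e \<in> join p q (S, T)" "f \<in> join p q (S, T)" "e \<noteq> f" for e f
      using that pw by (simp add: pairwise_def disjnt_def apart_imp_disjoint)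
    show "{} \<notin> join p q (S, T)"
      using two[of "{}"] by auto
  qed
  with pw two show ?thesis by (simp add: pairings_def)
qed

section \<open>Equality of the two counts\<close>

lemma a_num_eq_card_balanced_choices: "a_num p q = card (balanced_choices p q)"
proof -
  have "bij_betw split (pairings p q) (balanced_choices p q)"
  proof (rule bij_betw_byWitness[where f' = "join p q"])
    show "\<forall>M\<in>pairings p q. join p q (split M) = M"
      by (simp add: pairing_split(2))
    show "\<forall>Z\<in>balanced_choices p q. split (join p q Z) = Z"
      using split_join by (auto simp: balanced_choices_def)
    show "split ` pairings p q \<subseteq> balanced_choices p q"
      using pairing_split(1) by blast
    show "join p q ` balanced_choices p q \<subseteq> pairings p q"
      using join_mem_pairings by auto
  qed
  then show ?thesis
    using a_num_eq_card_pairings bij_betw_same_card by metis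
qed

theorem theorem9:
  fixes n :: nat
  shows "a_num n n = b_num n n"
proof -
  \<comment> \<open>By the bounds \<open>2 * card S \<le> n\<close> and
    \<open>2 * card T \<le> n\<close>, each truncated difference determines the number of chosen
    segments, so both sides amount to \<open>card S = card T\<close>.\<close>
  have "card (free_points n S) = card (free_points n T) \<longleftrightarrow>
      card (objects n S) = card (objects n T)"
    if "S \<in> segment_choices n" "T \<in> segment_choices n" for S T
    using segment_choice_card[OF that(1)] segment_choice_card[OF that(2)] by auto
  then have "balanced_choices n n = {(S, T). S \<in> segment_choices n \<and> T \<in> segment_choices n \<and>
      card (objects n S) = card (objects n T)}"
    by (auto simp: balanced_choices_def)
  then show ?thesis
    by (simp add: a_num_eq_card_balanced_choices b_num_def)
qed

end
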